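(* Let $\rho,\sigma>0$ be fixed, and let $(z,w)\in\mathcal E$, $z,w>0$, be the unique pair satisfying $$\ln\Big(\frac z{u}\Big)\big(\rho-\rho(\bar c^{z,w})\big)+\ln\Big(\frac w{v}\Big)\big(\sigma-\sigma(\bar c^{z,w})\big)\ge0\quad\text{for all } u,v>0\text{ with }(u,v)\in\mathcal E.$$ Let $u,v>0$ be any pair with $(u,v)\in\mathcal E$. Then any minimising sequence $(c^n)\subset X^+_{\rho,\sigma}$ of $H[\,\cdot\,|\bar c^{u,v}]$ over $X^+_{\rho,\sigma}$, i.e. any sequence in $X^+_{\rho,\sigma}$ with $H[c^n|\bar c^{u,v}]\to\inf_{c\in X^+_{\rho,\sigma}}H[c|\bar c^{u,v}]$, satisfies $c^n\overset{\ast}{\rightharpoonup}\bar c^{z,w}$.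
   Context: $\Omega=\{(r,s)\in\mathbb N_0^2 : r+s\ge1\}$, and $Q_{r,s}>0$, $(r,s)\in\Omega$, are given positive numbers with $Q_{1,0}=Q_{0,1}=1$. For $z,w\ge0$ let $\bar c^{z,w}_{r,s}=z^rw^sQ_{r,s}$. For a nonnegative sequence $c$ on $\Omega$, $\rho(c)=\sum_{(r,s)\in\Omega}r\,c_{r,s}$ and $\sigma(c)=\sum_{(r,s)\in\Omega}s\,c_{r,s}$. The region of existence is $\mathcal E=\{(z,w): z\ge0,\ w\ge0,\ \rho(\bar c^{z,w})+\sigma(\bar c^{z,w})<\infty\}$; it is assumed to contain a pair with both entries positive. (Under this assumption the pair $(z,w)$ in the claim is known to exist and be unique.) $X$ is the Banach space of real sequences with $\|c\|=\sum_{(r,s)\in\Omega}(r+s)|c_{r,s}|<\infty$, $X^+$ its subset of nonnegative sequences, and $X^+_{\rho,\sigma}=\{c\in X^+: \rho(c)=\rho,\ \sigma(c)=\sigma\}$. The weak* topology on $X$ comes from identifying $X$ with the dual of $Y=\{(y_{r,s})_{(r,s)\in\Omega}: \frac{y_{r,s}}{r+s}\to0\text{ as }r+s\to\infty\}$ (norm $\sup|y_{r,s}|/(r+s)$) via $\langle c,y\rangle=\sum c_{r,s}y_{r,s}$; equivalently, $c^n\overset{\ast}{\rightharpoonup}c$ iff $\sup_n\|c^n\|<\infty$ and $c^n_{r,s}\to c_{r,s}$ for all $(r,s)\in\Omega$. For $z,w>0$ with $(z,w)\in\mathcal E$ and $c\in X^+$ the relative entropy is $$H[c|\bar c^{z,w}]=\sum_{(r,s)\in\Omega}\bar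 c^{z,w}_{r,s}\Psi\Big(\frac{c_{r,s}}{\bar c^{z,w}_{r,s}}\Big)\in[0,\infty],\qquad\Psi(x)=x\ln x+1-x\ge0,\quad \Psi(0)=1.$$ *)

theory Defs
  imports "HOL-Analysis.Analysis"
begin

text \<open>
  Sequences indexed by \<open>\<Omega>\<close> are functions on \<^typ>\<open>nat \<times> nat\<close>; the value at
  \<open>(0, 0)\<close>, the only index outside \<open>\<Omega>\<close>, never plays a role.
\<close>

definition Omega :: "(nat \<times> nat) set" where
  "Omega = {(r, s). r + s \<ge> 1}"

definition cbar :: "(nat \<times> nat \<Rightarrow> real) \<Rightarrow> real \<Rightarrow> real \<Rightarrow> nat \<times> nat \<Rightarrow> real" where
  "cbar Q z w = (\<lambda>(r, s). z ^ r * w ^ s * Q (r, s))"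

text \<open>
  The moments are only used for nonnegative sequences, for which they take values in
  \<open>[0, \<infinity>]\<close> (\<^const>\<open>ennreal\<close> would replace negative terms by 0).
\<close>

definition rho_mom :: "(nat \<times> nat \<Rightarrow> real) \<Rightarrow> ennreal" where
  "rho_mom c = (\<Sum>\<^sub>\<infinity>(r, s)\<in>Omega. ennreal (real r * c (r, s)))"

definition sigma_mom :: "(nat \<times> nat \<Rightarrow> real) \<Rightarrow> ennreal" where
  "sigma_mom c = (\<Sum>\<^sub>\<infinity>(r, s)\<in>Omega. ennreal (real s * c (r, s)))"

definition existence_region :: "(nat \<times> nat \<Rightarrow> real) \<Rightarrow> (real \<times> real) set" where
  "existence_region Q =
     {(z, w). z \<ge> 0 \<and> w \<ge> 0 \<and> rho_mom (cbar Q z w) + sigma_mom (cbar Q z w) < \<infinity>}"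

definition X_space :: "(nat \<times> nat \<Rightarrow> real) set" where
  "X_space = {c. (\<lambda>(r, s). real (r + s) * \<bar>c (r, s)\<bar>) summable_on Omega}"

definition X_plus :: "(nat \<times> nat \<Rightarrow> real) set" where
  "X_plus = {c \<in> X_space. \<forall>p\<in>Omega. 0 \<le> c p}"

definition X_plus_mom :: "real \<Rightarrow> real \<Rightarrow> (nat \<times> nat \<Rightarrow> real) set" where
  "X_plus_mom \<rho> \<sigma> = {c \<in> X_plus. rho_mom c = ennreal \<rho> \<and> sigma_mom c = ennreal \<sigma>}"

definition Y_space :: "(nat \<times> nat \<Rightarrow> real) set" where
  "Y_space = {y. ((\<lambda>(r, s). y (r, s) / real (r + s)) \<longlongrightarrow> 0)
                   (filtercomap (\<lambda>(r, s). r + s) at_top)}"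

definition pairing :: "(nat \<times> nat \<Rightarrow> real) \<Rightarrow> (nat \<times> nat \<Rightarrow> real) \<Rightarrow> real" where
  "pairing c y = (\<Sum>\<^sub>\<infinity>p\<in>Omega. c p * y p)"

text \<open>
  The weak* topology is the initial topology on \<open>X\<close> for the functionals
  \<open>c \<mapsto> \<langle>c, y\<rangle>\<close>, \<open>y \<in> Y\<close>.
\<close>

definition weak_star_topology :: "(nat \<times> nat \<Rightarrow> real) topology" where
  "weak_star_topology =
     pullback_topology X_space (\<lambda>c. \<lambda>y\<in>Y_space. pairing c y)
       (product_topology (\<lambda>_. euclideanreal) Y_space)"

text \<open>Since \<open>ln 0 = 0\<close> in HOL, this formula gives \<open>\<Psi>(0) = 1\<close>.\<close>

definition Psi :: "real \<Rightarrow> real" where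
  "Psi x = x * ln x + 1 - x"

text \<open>
  \<open>rel_entropy c d\<close> is \<open>H[c|d]\<close>, meaningful for \<open>c \<ge> 0\<close> and \<open>d > 0\<close> on \<open>\<Omega>\<close>, where
  all terms are nonnegative.
\<close>

definition rel_entropy :: "(nat \<times> nat \<Rightarrow> real) \<Rightarrow> (nat \<times> nat \<Rightarrow> real) \<Rightarrow> ennreal" where
  "rel_entropy c d = (\<Sum>\<^sub>\<infinity>p\<in>Omega. ennreal (d p * Psi (c p / d p)))"

lemma topspace_weak_star: "topspace weak_star_topology = X_space"
  by (auto simp: weak_star_topology_def topspace_pullback_topology)

lemma limitin_weak_star_iff:
  assumes f: "\<And>n. f n \<in> X_space"
  shows "limitin weak_star_topology f l sequentially \<longleftrightarrow>
    l \<in> X_space \<and> (\<forall>y\<in>Y_space. (\<lambda>n. pairing (f n) y) \<longlonglongrightarrow> pairing l y)"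
    (is "_ \<longleftrightarrow> ?R")
proof -
  let ?T = "product_topology (\<lambda>_. euclideanreal) Y_space"
  let ?e = "\<lambda>c. \<lambda>y\<in>Y_space. pairing c y"
  have "limitin weak_star_topology f l sequentially \<longleftrightarrow>
      l \<in> X_space \<and> limitin ?T (\<lambda>n. ?e (f n)) (?e l) sequentially"
  proof
    assume L: "limitin weak_star_topology f l sequentially"
    have "l \<in> X_space"
      using limitin_topspace[OF L] by (simp only: topspace_weak_star)
    moreover have "continuous_map weak_star_topology ?T ?e"
      using continuous_map_pullback[OF continuous_map_id, of X_space ?e ?T]
      unfolding weak_star_topology_def id_comp .
    from continuous_map_limit[OF this L]
    have "limitin ?T (\<lambda>n. ?e (f n)) (?e l) sequentially"
      unfolding o_def .
    ultimately show "l \<in> X_space \<and> limitin ?T (\<lambda>n. ?e (f n)) (?e l) sequentially" ..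
  next
    assume R: "l \<in> X_space \<and> limitin ?T (\<lambda>n. ?e (f n)) (?e l) sequentially"
    show "limitin weak_star_topology f l sequentially"
      unfolding limitin_def topspace_weak_star
    proof (intro conjI allI impI)
      show "l \<in> X_space" using R ..
      fix U assume U: "openin weak_star_topology U \<and> l \<in> U"
      then obtain V where V: "openin ?T V" "U = ?e -` V \<inter> X_space"
        unfolding weak_star_topology_def openin_pullback_topology by blast
      with U have "?e l \<in> V" by blast
      with R V(1) have "\<forall>\<^sub>F n in sequentially. ?e (f n) \<in> V"
        unfolding limitin_def by blast
      then show "\<forall>\<^sub>F n in sequentially. f n \<in> U"
        by (rule eventually_mono) (simp add: V(2) f)
    qed
  qed
  also have "\<dots> \<longleftrightarrow> ?R"
    by (simp add: limitin_componentwise)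
  finally show ?thesis .
qed

end

theory Submission
  imports Defs
begin

text \<open>
  On \<open>X\<^sup>+\<^bsub>\<rho>,\<sigma>\<^esub>\<close> the entropies relative to \<open>cbar Q u v\<close> and to
  \<open>C = cbar Q z w\<close> differ by a constant, so it suffices that \<open>inf H[\<cdot>|C] = 0\<close> there: then
  \<open>\<Psi>(c\<^sup>n/C) \<longlongrightarrow> 0\<close> termwise, hence \<open>c\<^sup>n \<longlongrightarrow> C\<close> pointwise, and the moments bound the norm.

  The infimum is computed by convex duality. Let \<open>(a, b)\<close> be the excess moments
  \<open>(\<rho> - \<rho>(C), \<sigma> - \<sigma>(C))\<close>. If all finitely supported perturbations of \<open>C\<close> with moments
  \<open>(a, b)\<close> had entropy at least \<open>\<delta> > 0\<close>, a separating hyperplane in \<open>\<real>\<^sup>3\<close> would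
  give slopes \<open>p\<close>, \<open>q\<close> such that
  \<open>\<Sum> C (exp (p r + q s) - 1 - p r - q s) \<le> p a + q b - \<delta>\<close> over every finite subset of \<open>\<Omega>\<close>.
  The left side is nonnegative, so \<open>p a + q b > 0\<close>; but the bound also puts
  \<open>(z exp (p - \<epsilon>), w exp (q - \<epsilon>))\<close> into the region of existence for every \<open>\<epsilon> > 0\<close>,
  and the variational inequality then yields \<open>p a + q b \<le> 0\<close>.
\<close>

section \<open>The entropy density \<open>Psi\<close>: convexity and a quantitative lower
  bound\<close>

text \<open>After cancellation this is \<open>ln t \<le> t - 1\<close> at \<open>t = m / x\<close>,
  multiplied by \<open>x\<close>. The endpoint \<open>x = 0\<close>, where \<open>Psi\<close> has no
  derivative, is covered by direct evaluation, so both nonnegativity and convexity can be drawn from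
  it on all of \<open>{0..}\<close>.\<close>

lemma Psi_tangent_line:
  assumes "m > 0" "x \<ge> 0"
  shows "Psi m + ln m * (x - m) \<le> Psi x"
proof (cases "x = 0")
  case True
  then show ?thesis using assms by (simp add: Psi_def algebra_simps)
next
  case False
  with assms have x: "x > 0" by simp
  have "ln (m / x) \<le> m / x - 1"
    using x assms by (intro ln_le_minus_one) simp
  then have "x * ln (m / x) \<le> x * (m / x - 1)"
    using x by (intro mult_left_mono) auto
  then show ?thesis
    using x assms by (simp add: Psi_def ln_div algebra_simps)
qed

lemma Psi_nonneg: "x \<ge> 0 \<Longrightarrow> 0 \<le> Psi x"
  using Psi_tangent_line[of 1 x] by (simp add: Psi_def)

lemma Psi_1 [simp]: "Psi 1 = 0"
  by (simp add: Psi_def)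

text \<open>The supporting line at the convex combination \<open>m\<close> is evaluated at
  \<open>x\<close> and \<open>y\<close> and averaged; its linear part then cancels. The line exists
  only for \<open>m > 0\<close>, and \<open>m \<le> 0\<close> forces both endpoints to be 0.\<close>

lemma convex_on_Psi: "convex_on {0..} Psi"
proof (rule convex_onI)
  fix t x y :: real
  assume t: "0 < t" "t < 1" and xy: "x \<in> {0..}" "y \<in> {0..}"
  define m where "m = (1 - t) * x + t * y"
  have "0 \<le> (1 - t) * x" "0 \<le> t * y" using t xy by auto
  then have "(1 - t) * x = 0 \<and> t * y = 0" if "m \<le> 0"
    using that unfolding m_def by linarith
  then consider "x = 0" "y = 0" | "m > 0"
    using t by fastforce
  then have "Psi m \<le> (1 - t) * Psi x + t * Psi y"
  proof cases
    case 1
    then show ?thesis using t by (simp add: m_def Psi_def)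
  next
    case 2
    have "(1 - t) * (Psi m + ln m * (x - m)) \<le> (1 - t) * Psi x"
      "t * (Psi m + ln m * (y - m)) \<le> t * Psi y"
      using t xy Psi_tangent_line[OF 2] by (auto intro!: mult_left_mono)
    moreover have "(1 - t) * (Psi m + ln m * (x - m)) + t * (Psi m + ln m * (y - m))
        = Psi m + ln m * ((1 - t) * x + t * y - m)"
      by (simp add: algebra_simps)
    ultimately show ?thesis by (simp add: m_def)
  qed
  then show "Psi ((1 - t) *\<^sub>R x + t *\<^sub>R y) \<le> (1 - t) * Psi x + t * Psi y"
    by (simp add: m_def)
qed simp

text \<open>Expanding the square leaves \<open>x * ln x - 2 * x + 2 * sqrt x \<ge> 0\<close>, which
  is \<open>ln t \<le> t - 1\<close> at \<open>t = 1 / sqrt x\<close>, multiplied by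
  \<open>2 * x\<close>. The bound converts smallness of \<open>Psi x\<close> directly into closeness
  of \<open>x\<close> to 1.\<close>

lemma sqrt_square_le_Psi:
  assumes "x \<ge> 0"
  shows "(sqrt x - 1)\<^sup>2 \<le> Psi x"
proof (cases "x = 0")
  case True
  then show ?thesis by (simp add: Psi_def)
next
  case False
  with assms have x: "x > 0" by simp
  have "ln (1 / sqrt x) \<le> 1 / sqrt x - 1"
    using x by (intro ln_le_minus_one) simp
  then have "2 * x * ln (1 / sqrt x) \<le> 2 * x * (1 / sqrt x - 1)"
    using x by (intro mult_left_mono) auto
  moreover have "ln (1 / sqrt x) = - ln x / 2"
    using x by (simp add: ln_div ln_sqrt)
  moreover have "x * 2 / sqrt x = 2 * sqrt x"
    using real_div_sqrt[OF assms] by (metis mult.commute times_divide_eq_right)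
  ultimately show ?thesis
    using x by (simp add: Psi_def power2_eq_square algebra_simps)
qed

lemma tendsto_1_if_Psi_tendsto_0:
  assumes "\<And>n. x n \<ge> 0" and "((\<lambda>n. Psi (x n)) \<longlongrightarrow> 0) F"
  shows "(x \<longlongrightarrow> 1) F"
proof -
  have "((\<lambda>n. (sqrt (x n) - 1)\<^sup>2) \<longlongrightarrow> 0) F"
    by (rule tendsto_sandwich[OF _ _ tendsto_const assms(2)])
      (auto intro!: always_eventually sqrt_square_le_Psi assms(1))
  then have "((\<lambda>n. sqrt (x n) - 1) \<longlongrightarrow> 0) F"
    by (simp add: power_tendsto_0_iff)
  then have "((\<lambda>n. sqrt (x n)) \<longlongrightarrow> 1) F"
    by (simp add: LIM_zero_iff)
  from tendsto_power[OF this, of 2] show ?thesis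
    by (simp add: assms(1))
qed

section \<open>Sums in \<open>ennreal\<close> versus real sums\<close>

lemma ennreal_infsum:
  fixes f :: "'a \<Rightarrow> real"
  assumes "f summable_on A" "\<And>x. x \<in> A \<Longrightarrow> f x \<ge> 0"
  shows "(\<Sum>\<^sub>\<infinity>x\<in>A. ennreal (f x)) = ennreal (infsum f A)"
proof -
  have "infsum (ennreal \<circ> f) A = ennreal (infsum f A)"
    using assms by (intro infsum_comm_additive_general) (auto intro!: sum_ennreal)
  then show ?thesis by (simp add: o_def)
qed

lemma summable_on_if_ennreal_infsum_finite:
  fixes f :: "'a \<Rightarrow> real"
  assumes "(\<Sum>\<^sub>\<infinity>x\<in>A. ennreal (f x)) < \<infinity>" "\<And>x. x \<in> A \<Longrightarrow> f x \<ge> 0"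
  shows "f summable_on A"
proof (rule nonneg_bdd_above_summable_on)
  let ?S = "\<Sum>\<^sub>\<infinity>x\<in>A. ennreal (f x)"
  show "bdd_above (sum f ` {F. F \<subseteq> A \<and> finite F})"
  proof (rule bdd_aboveI2)
    fix F assume "F \<in> {F. F \<subseteq> A \<and> finite F}"
    then have F: "F \<subseteq> A" "finite F" by auto
    have "ennreal (sum f F) = (\<Sum>\<^sub>\<infinity>x\<in>F. ennreal (f x))"
      using F assms(2) by (subst infsum_finite) (auto intro!: sum_ennreal[symmetric])
    also have "\<dots> \<le> ?S"
      using F by (intro infsum_mono_neutral nonneg_summable_on_complete) auto
    finally have "enn2real (ennreal (sum f F)) \<le> enn2real ?S"
      using assms(1) by (intro enn2real_mono) (auto simp: less_top)
    moreover have "0 \<le> sum f F"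
      using F assms(2) by (intro sum_nonneg) auto
    ultimately show "sum f F \<le> enn2real ?S"
      by simp
  qed
qed (use assms in auto)

section \<open>The norm of X, the predual Y and weak* convergence\<close>

definition cluster_size :: "nat \<times> nat \<Rightarrow> real" where
  "cluster_size p = real (fst p) + real (snd p)"

lemma cluster_size_ge_1: "p \<in> Omega \<Longrightarrow> 1 \<le> cluster_size p"
  by (auto simp: cluster_size_def Omega_def split: prod.splits)

lemma X_space_iff: "c \<in> X_space \<longleftrightarrow> (\<lambda>p. cluster_size p * \<bar>c p\<bar>) summable_on Omega"
  by (simp add: X_space_def cluster_size_def case_prod_unfold)

lemma Y_space_small_off_finite:
  assumes "y \<in> Y_space" "e > 0"
  obtains F where "finite F" "F \<subseteq> Omega" "\<And>p. p \<in> Omega - F \<Longrightarrow> \<bar>y p\<bar> \<le> e * cluster_size p"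
proof -
  have "\<forall>\<^sub>F p in filtercomap (\<lambda>(r, s). r + s) at_top. \<bar>case p of (r, s) \<Rightarrow> y (r, s) / real (r + s)\<bar> < e"
    using tendstoD[OF assms(1)[unfolded Y_space_def mem_Collect_eq] assms(2)] by simp
  then obtain N where N: "\<And>r s. r + s \<ge> N \<Longrightarrow> \<bar>y (r, s) / real (r + s)\<bar> < e"
    unfolding eventually_filtercomap eventually_at_top_linorder by fastforce
  show thesis
  proof (rule that)
    \<comment> \<open>A pair outside the box has a coordinate exceeding \<open>N\<close>, so its
      size is at least \<open>N\<close> and nonzero; the division by \<open>r + s\<close> is then
      harmless.\<close>
    show "finite ({..N} \<times> {..N} \<inter> Omega)" by blast
    fix p assume p: "p \<in> Omega - {..N} \<times> {..N} \<inter> Omega"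
    obtain r s where rs: "p = (r, s)" by (cases p)
    have "r + s \<ge> N" "r + s > 0" using p rs by auto
    with N[of r s] show "\<bar>y p\<bar> \<le> e * cluster_size p"
      by (simp add: rs cluster_size_def abs_divide field_simps)
  qed auto
qed

text \<open>The pairing is split into a finite head, kept exactly, and a tail paid for by
  \<open>e\<close> times the norm of \<open>c\<close>. The dominating function \<open>?h\<close>
  keeps the tail term on \<open>F\<close> too, so that its sum contains the full norm.\<close>

lemma pairing_bound:
  assumes c: "c \<in> X_space" and F: "finite F" "F \<subseteq> Omega"
    and y: "\<And>p. p \<in> Omega - F \<Longrightarrow> \<bar>y p\<bar> \<le> e * cluster_size p" and e: "e \<ge> 0"
  shows "(\<lambda>p. c p * y p) summable_on Omega"
    and "\<bar>pairing c y\<bar> \<le> e * (\<Sum>\<^sub>\<infinity>p\<in>Omega. cluster_size p * \<bar>c p\<bar>) + (\<Sum>p\<in>F. \<bar>c p * y p\<bar>)"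
proof -
  let ?g = "\<lambda>p. if p \<in> F then \<bar>c p * y p\<bar> else 0"
  let ?h = "\<lambda>p. e * (cluster_size p * \<bar>c p\<bar>) + ?g p"
  have g: "?g summable_on Omega" "infsum ?g Omega = (\<Sum>p\<in>F. \<bar>c p * y p\<bar>)"
  proof -
    have "(?g has_sum (\<Sum>p\<in>F. \<bar>c p * y p\<bar>)) Omega \<longleftrightarrow> ((\<lambda>p. \<bar>c p * y p\<bar>) has_sum (\<Sum>p\<in>F. \<bar>c p * y p\<bar>)) F"
      using F by (intro has_sum_cong_neutral) auto
    then have "(?g has_sum (\<Sum>p\<in>F. \<bar>c p * y p\<bar>)) Omega"
      using F by (simp add: has_sum_finite)
    then show "?g summable_on Omega" "infsum ?g Omega = (\<Sum>p\<in>F. \<bar>c p * y p\<bar>)"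
      by (auto simp: summable_on_def infsumI)
  qed
  have s: "(\<lambda>p. e * (cluster_size p * \<bar>c p\<bar>)) summable_on Omega"
    using c by (intro summable_on_cmult_right) (simp add: X_space_iff)
  have h: "?h summable_on Omega"
    by (rule summable_on_add[OF s g(1)])
  have le: "norm (c p * y p) \<le> ?h p" if "p \<in> Omega" for p
  proof (cases "p \<in> F")
    case True
    then show ?thesis using e by (simp add: cluster_size_def)
  next
    case False
    then have "\<bar>c p\<bar> * \<bar>y p\<bar> \<le> \<bar>c p\<bar> * (e * cluster_size p)"
      using y that by (intro mult_left_mono) auto
    then show ?thesis using False by (simp add: abs_mult mult_ac)
  qed
  have a: "(\<lambda>p. norm (c p * y p)) summable_on Omega"
    by (rule summable_on_comparison_test[OF h le]) auto
  then show "(\<lambda>p. c p * y p) summable_on Omega"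
    by (rule abs_summable_summable)
  have "\<bar>pairing c y\<bar> \<le> (\<Sum>\<^sub>\<infinity>p\<in>Omega. norm (c p * y p))"
    unfolding pairing_def using norm_infsum_bound[OF a] by simp
  also have "\<dots> \<le> infsum ?h Omega"
    by (rule infsum_mono[OF a h le])
  also have "\<dots> = e * (\<Sum>\<^sub>\<infinity>p\<in>Omega. cluster_size p * \<bar>c p\<bar>) + (\<Sum>p\<in>F. \<bar>c p * y p\<bar>)"
    by (subst infsum_add[OF s g(1)]) (simp add: g(2) infsum_cmult_right')
  finally show "\<bar>pairing c y\<bar> \<le> \<dots>" .
qed

text \<open>A test sequence in \<open>Y_space\<close> is small relative to the norm weight off a
  finite set. There the uniform norm bound controls the difference of the pairings; on the finite
  set pointwise convergence does.\<close>

lemma weak_star_limit_if_bounded_pointwise: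
  assumes c: "\<And>n. c n \<in> X_space" and l: "l \<in> X_space"
    and bound: "\<And>n. (\<Sum>\<^sub>\<infinity>p\<in>Omega. cluster_size p * \<bar>c n p\<bar>) \<le> M"
    and pointwise: "\<And>p. p \<in> Omega \<Longrightarrow> (\<lambda>n. c n p) \<longlonglongrightarrow> l p"
  shows "limitin weak_star_topology c l sequentially"
  unfolding limitin_weak_star_iff[OF c]
proof (intro conjI ballI l)
  fix y assume y: "y \<in> Y_space"
  define L where "L = (\<Sum>\<^sub>\<infinity>p\<in>Omega. cluster_size p * \<bar>l p\<bar>)"
  have nonneg: "0 \<le> (\<Sum>\<^sub>\<infinity>p\<in>Omega. cluster_size p * \<bar>c' p\<bar>)" for c'
    by (intro infsum_nonneg) (simp add: cluster_size_def)
  have ML0: "0 \<le> M" "0 \<le> L" using nonneg[of "c 0"] bound[of 0] nonneg[of l] by (auto simp: L_def)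
  show "(\<lambda>n. pairing (c n) y) \<longlonglongrightarrow> pairing l y"
  proof (rule tendstoI)
    fix \<epsilon> :: real assume "\<epsilon> > 0"
    \<comment> \<open>\<open>M + L\<close> bounds the norm of \<open>c n - l\<close>, so this
      \<open>e\<close> makes the tail at most half of \<open>\<epsilon>\<close>; the summand 1 keeps
      the denominator positive.\<close>
    define e where "e = \<epsilon> / (2 * (M + L + 1))"
    have e: "e > 0" using \<open>\<epsilon> > 0\<close> ML0 by (simp add: e_def)
    have "e * (M + L) \<le> e * (M + L + 1)" using e by simp
    also have "\<dots> = \<epsilon> / 2" using ML0 by (simp add: e_def divide_simps)
    finally have half: "e * (M + L) \<le> \<epsilon> / 2" .
    obtain F where F: "finite F" "F \<subseteq> Omega"
      and small: "\<And>p. p \<in> Omega - F \<Longrightarrow> \<bar>y p\<bar> \<le> e * cluster_size p"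
      using Y_space_small_off_finite[OF y e] by blast
    have "(\<lambda>n. \<Sum>p\<in>F. \<bar>(c n p - l p) * y p\<bar>) \<longlonglongrightarrow> (\<Sum>p\<in>F. \<bar>(l p - l p) * y p\<bar>)"
      using F pointwise by (intro tendsto_intros) auto
    then have "(\<lambda>n. \<Sum>p\<in>F. \<bar>(c n p - l p) * y p\<bar>) \<longlonglongrightarrow> 0" by simp
    from order_tendstoD(2)[OF this, of "\<epsilon> / 2"]
    have ev: "\<forall>\<^sub>F n in sequentially. (\<Sum>p\<in>F. \<bar>(c n p - l p) * y p\<bar>) < \<epsilon> / 2"
      using \<open>\<epsilon> > 0\<close> by simp
    show "\<forall>\<^sub>F n in sequentially. dist (pairing (c n) y) (pairing l y) < \<epsilon>"
      using ev
    proof (rule eventually_mono)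
      fix n assume n: "(\<Sum>p\<in>F. \<bar>(c n p - l p) * y p\<bar>) < \<epsilon> / 2"
      let ?d = "\<lambda>p. c n p - l p"
      let ?b = "\<lambda>p. cluster_size p * \<bar>c n p\<bar> + cluster_size p * \<bar>l p\<bar>"
      have sb: "?b summable_on Omega"
        using c[of n] l by (intro summable_on_add) (simp_all add: X_space_iff)
      have le: "cluster_size p * \<bar>?d p\<bar> \<le> ?b p" for p
        unfolding distrib_left[symmetric]
        by (intro mult_left_mono) (auto simp: cluster_size_def)
      have dsum: "(\<lambda>p. cluster_size p * \<bar>?d p\<bar>) summable_on Omega"
        by (rule summable_on_comparison_test[OF sb le]) (simp add: cluster_size_def)
      then have dX: "?d \<in> X_space" by (simp add: X_space_iff)
      have "(\<Sum>\<^sub>\<infinity>p\<in>Omega. cluster_size p * \<bar>?d p\<bar>) \<le> infsum ?b Omega"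
        by (rule infsum_mono[OF dsum sb le])
      also have "\<dots> \<le> M + L"
        using c[of n] l bound[of n] by (subst infsum_add) (auto simp: X_space_iff L_def)
      finally have "e * (\<Sum>\<^sub>\<infinity>p\<in>Omega. cluster_size p * \<bar>?d p\<bar>) \<le> e * (M + L)"
        using e by (intro mult_left_mono) auto
      with pairing_bound(2)[OF dX F small less_imp_le[OF e]] half n
      have "\<bar>pairing ?d y\<bar> < \<epsilon>" by linarith
      moreover have "pairing ?d y = pairing (c n) y - pairing l y"
      proof -
        have "(\<lambda>p. c n p * y p) summable_on Omega" "(\<lambda>p. l p * y p) summable_on Omega"
          using pairing_bound(1)[OF c F small] pairing_bound(1)[OF l F small] e by auto
        then have "(\<Sum>\<^sub>\<infinity>p\<in>Omega. c n p * y p + - (l p * y p)) = pairing (c n) y + - pairing l y"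
          unfolding pairing_def by (subst infsum_add) (simp_all add: infsum_uminus summable_on_uminus)
        then show ?thesis by (simp add: pairing_def left_diff_distrib)
      qed
      ultimately show "dist (pairing (c n) y) (pairing l y) < \<epsilon>"
        by (simp add: dist_real_def)
    qed
  qed
qed

section \<open>Finitely supported perturbations and their convex epigraph\<close>

text \<open>\<open>F\<close> only has to contain the support of \<open>d\<close>. This freedom lets
  two perturbations be compared on a common index set.\<close>

definition finite_perturbation ::
    "(nat \<times> nat \<Rightarrow> real) \<Rightarrow> (nat \<times> nat) set \<Rightarrow> (nat \<times> nat \<Rightarrow> real) \<Rightarrow> bool" where
  "finite_perturbation C F d \<longleftrightarrow>
     finite F \<and> F \<subseteq> Omega \<and> (\<forall>x. x \<notin> F \<longrightarrow> d x = 0) \<and> (\<forall>x\<in>F. 0 \<le> C x + d x)"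

definition perturbation_data ::
    "(nat \<times> nat \<Rightarrow> real) \<Rightarrow> (nat \<times> nat) set \<Rightarrow> (nat \<times> nat \<Rightarrow> real) \<Rightarrow> real \<times> real \<times> real" where
  "perturbation_data C F d =
     (\<Sum>x\<in>F. real (fst x) * d x, \<Sum>x\<in>F. real (snd x) * d x, \<Sum>x\<in>F. C x * Psi ((C x + d x) / C x))"

text \<open>Up to boundary points, this is the epigraph of the value function sending excess moments
  to the least entropy of a finite perturbation. Closing upwards in the third coordinate is what
  makes the set convex.\<close>

definition perturbation_epigraph :: "(nat \<times> nat \<Rightarrow> real) \<Rightarrow> (real \<times> real \<times> real) set" where
  "perturbation_epigraph C =
     {(x, y, t). \<exists>F d h. finite_perturbation C F d \<and> perturbation_data C F d = (x, y, h) \<and> h \<le> t}"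

text \<open>At the added indices \<open>d\<close> vanishes, so the ratio is 1 and
  \<open>Psi 1 = 0\<close>: nothing changes in the moments or in the entropy.\<close>

lemma finite_perturbation_superset:
  assumes "finite_perturbation C F d" "F \<subseteq> G" "finite G" "G \<subseteq> Omega"
    and C: "\<And>p. p \<in> Omega \<Longrightarrow> C p > 0"
  shows "finite_perturbation C G d" "perturbation_data C G d = perturbation_data C F d"
proof -
  have d0: "d x = 0" if "x \<notin> F" for x
    using assms(1) that unfolding finite_perturbation_def by blast
  have "0 \<le> C x + d x" if "x \<in> G" for x
  proof (cases "x \<in> F")
    case True
    then show ?thesis using assms(1) unfolding finite_perturbation_def by blast
  next
    case False
    have "C x > 0" using C that \<open>G \<subseteq> Omega\<close> by blast
    then show ?thesis using d0[OF False] by simp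
  qed
  then show "finite_perturbation C G d"
    unfolding finite_perturbation_def using assms(2-4) d0 by blast
  have "Psi ((C x + d x) / C x) = 0" if "x \<in> G - F" for x
  proof -
    have "C x > 0" using C that \<open>G \<subseteq> Omega\<close> by blast
    then show ?thesis using d0[of x] that by simp
  qed
  then show "perturbation_data C G d = perturbation_data C F d"
    unfolding perturbation_data_def using assms d0
    by (auto intro!: sum.mono_neutral_right)
qed

text \<open>On a common index set the excess moments are linear in \<open>d\<close>, while the
  entropy is convex in \<open>d\<close> by convexity of \<open>Psi\<close>.\<close>

lemma convex_perturbation_epigraph:
  assumes C: "\<And>p. p \<in> Omega \<Longrightarrow> C p > 0"
  shows "convex (perturbation_epigraph C)"
proof (rule convexI)
  fix P P' :: "real \<times> real \<times> real" and u v :: real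
  assume P: "P \<in> perturbation_epigraph C" "P' \<in> perturbation_epigraph C"
    and uv: "0 \<le> u" "0 \<le> v" "u + v = 1"
  obtain x y t where P_eq: "P = (x, y, t)" by (cases P)
  obtain x' y' t' where P'_eq: "P' = (x', y', t')" by (cases P')
  from P obtain F d h F' d' h' where
    1: "finite_perturbation C F d" "perturbation_data C F d = (x, y, h)" "h \<le> t" and
    2: "finite_perturbation C F' d'" "perturbation_data C F' d' = (x', y', h')" "h' \<le> t'"
    unfolding perturbation_epigraph_def P_eq P'_eq by blast
  define G where "G = F \<union> F'"
  have G: "finite G" "G \<subseteq> Omega" "F \<subseteq> G" "F' \<subseteq> G"
    using 1(1) 2(1) by (auto simp: G_def finite_perturbation_def)
  note d = finite_perturbation_superset[OF 1(1) G(3,1,2) C]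
  note d' = finite_perturbation_superset[OF 2(1) G(4,1,2) C]
  define e where "e z = u * d z + v * d' z" for z
  have nonneg: "0 \<le> C z + d z" "0 \<le> C z + d' z" "C z > 0" if "z \<in> G" for z
    using d(1) d'(1) that C[of z] G by (auto simp: finite_perturbation_def)
  have comb: "C z + e z = u * (C z + d z) + v * (C z + d' z)" for z
  proof -
    have "C z = (u + v) * C z" using uv(3) by simp
    then show ?thesis by (simp add: e_def algebra_simps)
  qed
  have "finite_perturbation C G e"
    unfolding finite_perturbation_def comb
    using d(1) d'(1) nonneg uv by (auto simp: finite_perturbation_def e_def)
  moreover have "perturbation_data C G e =
      (u * x + v * x', u * y + v * y', \<Sum>z\<in>G. C z * Psi ((C z + e z) / C z))"
    using d(2) d'(2) 1(2) 2(2)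
    by (auto simp: perturbation_data_def e_def sum_distrib_left sum.distrib algebra_simps)
  moreover have "(\<Sum>z\<in>G. C z * Psi ((C z + e z) / C z)) \<le> u * t + v * t'"
  proof -
    have "C z * Psi ((C z + e z) / C z)
        \<le> u * (C z * Psi ((C z + d z) / C z)) + v * (C z * Psi ((C z + d' z) / C z))"
      if z: "z \<in> G" for z
    proof -
      have "(C z + d z) / C z \<in> {0..}" "(C z + d' z) / C z \<in> {0..}"
        using nonneg[OF z] by auto
      then have "Psi (u *\<^sub>R ((C z + d z) / C z) + v *\<^sub>R ((C z + d' z) / C z))
          \<le> u * Psi ((C z + d z) / C z) + v * Psi ((C z + d' z) / C z)"
        using uv convex_on_Psi[unfolded convex_on_def] by blast
      moreover have "u *\<^sub>R ((C z + d z) / C z) + v *\<^sub>R ((C z + d' z) / C z) = (C z + e z) / C z"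
        unfolding comb add_divide_distrib[of "u * (C z + d z)"] by simp
      ultimately have "Psi ((C z + e z) / C z)
          \<le> u * Psi ((C z + d z) / C z) + v * Psi ((C z + d' z) / C z)" by simp
      from mult_left_mono[OF this, of "C z"] nonneg(3)[OF z] show ?thesis
        by (simp add: algebra_simps)
    qed
    then have "(\<Sum>z\<in>G. C z * Psi ((C z + e z) / C z))
        \<le> (\<Sum>z\<in>G. u * (C z * Psi ((C z + d z) / C z)) + v * (C z * Psi ((C z + d' z) / C z)))"
      by (rule sum_mono)
    also have "\<dots> = u * h + v * h'"
      using d(2) d'(2) 1(2) 2(2)
      by (simp add: perturbation_data_def sum.distrib flip: sum_distrib_left)
    also have "\<dots> \<le> u * t + v * t'"
      using 1(3) 2(3) uv by (intro add_mono mult_left_mono)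
    finally show ?thesis .
  qed
  ultimately show "u *\<^sub>R P + v *\<^sub>R P' \<in> perturbation_epigraph C"
    unfolding perturbation_epigraph_def P_eq P'_eq by auto
qed

lemma perturbation_epigraphI:
  assumes "finite_perturbation C F d"
  shows "perturbation_data C F d \<in> perturbation_epigraph C"
  using assms unfolding perturbation_epigraph_def
  by (cases "perturbation_data C F d") auto

text \<open>Each of the two monomers contributes with weight 1 to exactly one moment, so the moments
  can be set independently. This supplies enough room around \<open>(a, b)\<close> to exclude a
  vertical separating hyperplane.\<close>

lemma perturbation_epigraph_monomers:
  assumes C: "\<And>p. p \<in> Omega \<Longrightarrow> C p > 0" and "- C (1, 0) \<le> m" "- C (0, 1) \<le> n"
  shows "\<exists>h. (m, n, h) \<in> perturbation_epigraph C"
proof -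
  define d where "d = (\<lambda>x. if x = (1, 0) then m else if x = (0 :: nat, 1 :: nat) then n else 0)"
  have "finite_perturbation C {(1, 0), (0, 1)} d"
    using assms(2,3) by (auto simp: finite_perturbation_def d_def Omega_def)
  from perturbation_epigraphI[OF this] show ?thesis
    by (auto simp: perturbation_data_def d_def)
qed

section \<open>Separation in three dimensions and exponential tilts\<close>

text \<open>The assumption \<open>normal_cone\<close> says that \<open>(a, b)\<close> lies in the
  normal cone at the origin of the set of exponents \<open>(p, q)\<close> whose tilt of
  \<open>C\<close> stays summable. A separating hyperplane would produce such a tilt with
  \<open>p * a + q * b > 0\<close>.\<close>

lemma small_entropy_perturbation:
  fixes C :: "nat \<times> nat \<Rightarrow> real" and a b \<delta> :: real
  assumes C: "\<And>p. p \<in> Omega \<Longrightarrow> C p > 0"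
    and sum: "(\<lambda>p. cluster_size p * C p) summable_on Omega"
    and ab: "a \<ge> 0" "b \<ge> 0" and \<delta>: "\<delta> > 0"
    and normal_cone: "\<And>p q. (\<lambda>x. C x * exp (p * real (fst x) + q * real (snd x))) summable_on Omega \<Longrightarrow>
      p * a + q * b \<le> 0"
  obtains F d h where "finite_perturbation C F d" "perturbation_data C F d = (a, b, h)" "h < \<delta>"
proof -
  have "\<exists>h<\<delta>. (a, b, h) \<in> perturbation_epigraph C"
  proof (rule ccontr)
    assume contra: "\<not> ?thesis"
    \<comment> \<open>The vertical ray over \<open>(a, b)\<close> strictly below height
      \<open>\<delta>\<close>: exactly what the epigraph must miss if the claim fails.\<close>
    define T where "T = {a} \<times> {b} \<times> {..<\<delta>}"
    have C10: "C (1, 0) > 0" "C (0, 1) > 0" by (auto intro!: C simp: Omega_def)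
    have mono: "\<exists>h. (m, n, h) \<in> perturbation_epigraph C" if "- C (1, 0) \<le> m" "- C (0, 1) \<le> n" for m n
      using perturbation_epigraph_monomers[OF C that] .
    have "\<exists>N c. N \<noteq> 0 \<and> (\<forall>x\<in>perturbation_epigraph C. inner N x \<le> c) \<and> (\<forall>x\<in>T. inner N x \<ge> c)"
    proof (rule separating_hyperplane_sets)
      show "convex (perturbation_epigraph C)" by (rule convex_perturbation_epigraph[OF C])
      show "convex T" unfolding T_def by (intro convex_Times) auto
      show "perturbation_epigraph C \<noteq> {}" using mono[of 0 0] C10 by auto
      show "T \<noteq> {}" unfolding T_def by auto
      show "perturbation_epigraph C \<inter> T = {}" using contra by (auto simp: T_def)
    qed
    then obtain \<alpha> \<beta> \<gamma> c where N: "(\<alpha>, \<beta>, \<gamma>) \<noteq> (0, 0, 0)"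
      and S: "\<And>x y t. (x, y, t) \<in> perturbation_epigraph C \<Longrightarrow> \<alpha> * x + \<beta> * y + \<gamma> * t \<le> c"
      and T: "\<And>t. t < \<delta> \<Longrightarrow> c \<le> \<alpha> * a + \<beta> * b + \<gamma> * t"
      unfolding T_def by (force simp: zero_prod_def inner_prod_def add.assoc)
    have "\<gamma> \<le> 0"
    proof (rule ccontr)
      assume "\<not> \<gamma> \<le> 0"
      then have g: "\<gamma> > 0" by simp
      \<comment> \<open>The ray \<open>T\<close> is unbounded below. The first entry of the minimum
        keeps \<open>t\<close> on the ray, the second pushes the functional down to at most
        \<open>c - 1\<close>.\<close>
      define t where "t = min (\<delta> - 1) ((c - \<alpha> * a - \<beta> * b - 1) / \<gamma>)"
      have "t \<le> (c - \<alpha> * a - \<beta> * b - 1) / \<gamma>" by (simp add: t_def)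
      then have "\<gamma> * t \<le> c - \<alpha> * a - \<beta> * b - 1" using g by (simp add: field_simps)
      moreover have "c \<le> \<alpha> * a + \<beta> * b + \<gamma> * t" by (rule T) (simp add: t_def)
      ultimately show False by linarith
    qed
    \<comment> \<open>A vertical hyperplane would make a linear functional of the moments maximal at
      \<open>(a, b)\<close>. Since \<open>a\<close> and \<open>b\<close> are nonnegative, each
      coordinate may move by a monomer density in both directions, so
      \<open>\<alpha> = \<beta> = 0\<close>.\<close>
    moreover have "\<gamma> \<noteq> 0"
    proof
      assume g: "\<gamma> = 0"
      have le: "\<alpha> * m + \<beta> * n \<le> \<alpha> * a + \<beta> * b" if "- C (1, 0) \<le> m" "- C (0, 1) \<le> n" for m n
        using mono[OF that] S T[of 0] \<delta> g by fastforce
      have "\<alpha> * C (1, 0) \<le> 0" "\<alpha> * - C (1, 0) \<le> 0"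
        using le[of "a + C (1, 0)" b] le[of "a - C (1, 0)" b] ab C10 by (auto simp: algebra_simps)
      then have "\<alpha> = 0" using C10 by (auto simp: mult_le_0_iff zero_le_mult_iff)
      moreover have "\<beta> * C (0, 1) \<le> 0" "\<beta> * - C (0, 1) \<le> 0"
        using le[of a "b + C (0, 1)"] le[of a "b - C (0, 1)"] ab C10 by (auto simp: algebra_simps)
      then have "\<beta> = 0" using C10 by (auto simp: mult_le_0_iff zero_le_mult_iff)
      ultimately show False using N g by simp
    qed
    ultimately have g: "\<gamma> < 0" by simp
    define p q where "p = - \<alpha> / \<gamma>" and "q = - \<beta> / \<gamma>"
    \<comment> \<open>Height \<open>\<delta>\<close> itself is not on the ray, so the estimate is
      taken at \<open>\<delta> - e\<close> for arbitrary \<open>e > 0\<close>. Division by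
      \<open>\<gamma> < 0\<close> reverses the inequality.\<close>
    have support: "p * x + q * y - t \<le> p * a + q * b - \<delta>"
      if "(x, y, t) \<in> perturbation_epigraph C" for x y t
    proof (rule field_le_epsilon)
      fix e :: real assume e: "e > 0"
      have "\<alpha> * x + \<beta> * y + \<gamma> * t \<le> \<alpha> * a + \<beta> * b + \<gamma> * (\<delta> - e)"
        using S[OF that] T[of "\<delta> - e"] e by linarith
      then have "(\<alpha> * a + \<beta> * b + \<gamma> * (\<delta> - e)) / \<gamma> \<le> (\<alpha> * x + \<beta> * y + \<gamma> * t) / \<gamma>"
        using g by (simp add: divide_right_mono_neg)
      then show "p * x + q * y - t \<le> p * a + q * b - \<delta> + e"
        using g by (simp add: p_def q_def add_divide_distrib)
    qed
    let ?x = "\<lambda>z. p * real (fst z) + q * real (snd z)"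
    have tilt: "(\<Sum>z\<in>F. C z * (exp (?x z) - 1 - ?x z)) \<le> p * a + q * b - \<delta>"
      if F: "finite F" "F \<subseteq> Omega" for F
    proof -
      \<comment> \<open>the perturbation for which Young's inequality for \<open>\<Psi>\<close> and its conjugate is an equality\<close>
      define d where "d z = (if z \<in> F then C z * (exp (?x z) - 1) else 0)" for z
      have Cd: "C z + d z = C z * exp (?x z)" "C z > 0" if "z \<in> F" for z
        using that F C[of z] by (auto simp: d_def algebra_simps)
      then have "finite_perturbation C F d"
        using F by (auto simp: finite_perturbation_def d_def less_imp_le)
      from support[OF perturbation_epigraphI[OF this, unfolded perturbation_data_def]]
      have "(\<Sum>z\<in>F. ?x z * d z - C z * Psi ((C z + d z) / C z)) \<le> p * a + q * b - \<delta>"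
        by (simp add: sum_subtractf sum.distrib sum_distrib_left algebra_simps)
      moreover have "?x z * d z - C z * Psi ((C z + d z) / C z) = C z * (exp (?x z) - 1 - ?x z)"
        if "z \<in> F" for z
      proof -
        have "(C z + d z) / C z = exp (?x z)" using Cd[OF that] by simp
        then show ?thesis using that by (simp add: d_def Psi_def algebra_simps)
      qed
      ultimately show ?thesis by simp
    qed
    \<comment> \<open>The empty index set already suffices: its sum is 0.\<close>
    have "0 < p * a + q * b" using tilt[of "{}"] \<delta> by simp
    moreover have "(\<lambda>x. C x * exp (?x x)) summable_on Omega"
    proof (rule nonneg_bdd_above_summable_on)
      \<comment> \<open>\<open>exp x\<close> is split as \<open>(exp x - 1 - x) + (1 + x)\<close>.
        The first part is bounded by \<open>tilt\<close>; \<open>K\<close> absorbs the linear part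
        into the norm weight, using that this weight is at least 1 on \<open>Omega\<close>.\<close>
      define K where "K = (1 + \<bar>p\<bar> + \<bar>q\<bar>)"
      show "bdd_above (sum (\<lambda>x. C x * exp (?x x)) ` {F. F \<subseteq> Omega \<and> finite F})"
      proof (rule bdd_aboveI2)
        fix F assume "F \<in> {F. F \<subseteq> Omega \<and> finite F}"
        then have F: "finite F" "F \<subseteq> Omega" by auto
        have "C z * exp (?x z) \<le> C z * (exp (?x z) - 1 - ?x z) + K * (cluster_size z * C z)"
          if "z \<in> F" for z
        proof -
          have "z \<in> Omega" using that F by auto
          have "?x z \<le> \<bar>p\<bar> * real (fst z) + \<bar>q\<bar> * real (snd z)"
            by (intro add_mono mult_right_mono) auto
          also have "\<dots> \<le> \<bar>p\<bar> * cluster_size z + \<bar>q\<bar> * cluster_size z"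
            by (intro add_mono mult_left_mono) (auto simp: cluster_size_def)
          finally have "1 + ?x z \<le> K * cluster_size z"
            using cluster_size_ge_1[OF \<open>z \<in> Omega\<close>] by (simp add: K_def algebra_simps)
          from mult_left_mono[OF this, of "C z"] C[OF \<open>z \<in> Omega\<close>] show ?thesis
            by (simp add: algebra_simps)
        qed
        then have "(\<Sum>z\<in>F. C z * exp (?x z))
            \<le> (\<Sum>z\<in>F. C z * (exp (?x z) - 1 - ?x z) + K * (cluster_size z * C z))"
          by (rule sum_mono)
        also have "\<dots> = (\<Sum>z\<in>F. C z * (exp (?x z) - 1 - ?x z)) + K * (\<Sum>z\<in>F. cluster_size z * C z)"
          by (simp only: sum.distrib sum_distrib_left)
        also have "\<dots> \<le> (p * a + q * b - \<delta>) + K * (\<Sum>\<^sub>\<infinity>z\<in>Omega. cluster_size z * C z)"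
        proof (intro add_mono mult_left_mono tilt F finite_sum_le_infsum sum)
          show "0 \<le> cluster_size z * C z" if "z \<in> Omega - F" for z
            using that C[of z] by (simp add: cluster_size_def)
        qed (simp add: K_def)
        finally show "(\<Sum>z\<in>F. C z * exp (?x z))
            \<le> (p * a + q * b - \<delta>) + K * (\<Sum>\<^sub>\<infinity>z\<in>Omega. cluster_size z * C z)" .
      qed
    qed (use C in \<open>auto simp: less_imp_le\<close>)
    ultimately show False using normal_cone by fastforce
  qed
  then show thesis
    using that unfolding perturbation_epigraph_def by fastforce
qed

section \<open>Real-valued moments, the region of existence and the change of reference\<close>

lemma X_plus_momI:
  assumes "\<And>p. p \<in> Omega \<Longrightarrow> 0 \<le> c p"
    and \<rho>: "((\<lambda>p. real (fst p) * c p) has_sum \<rho>) Omega"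
    and \<sigma>: "((\<lambda>p. real (snd p) * c p) has_sum \<sigma>) Omega"
  shows "c \<in> X_plus_mom \<rho> \<sigma>"
proof -
  have "(\<lambda>p. cluster_size p * c p) summable_on Omega"
    using has_sum_imp_summable[OF has_sum_add[OF \<rho> \<sigma>]]
    by (simp add: cluster_size_def distrib_right)
  then have "(\<lambda>p. cluster_size p * \<bar>c p\<bar>) summable_on Omega"
    by (rule summable_on_cong[THEN iffD1, rotated]) (simp add: assms(1))
  moreover have "rho_mom c = ennreal \<rho>" "sigma_mom c = ennreal \<sigma>"
    unfolding rho_mom_def sigma_mom_def case_prod_unfold prod.collapse
    using ennreal_infsum[OF has_sum_imp_summable[OF \<rho>]] ennreal_infsum[OF has_sum_imp_summable[OF \<sigma>]]
    by (simp_all add: assms(1) infsumI[OF \<rho>] infsumI[OF \<sigma>])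
  ultimately show ?thesis
    using assms(1) by (simp add: X_plus_mom_def X_plus_def X_space_iff)
qed

text \<open>Since \<open>ennreal\<close> sends every negative number to 0, nonnegativity of
  \<open>\<rho>\<close> and \<open>\<sigma>\<close> is what allows \<open>ennreal\<close> to be
  cancelled from the moment equations.\<close>

lemma X_plus_momD:
  assumes c: "c \<in> X_plus_mom \<rho> \<sigma>" and "\<rho> \<ge> 0" "\<sigma> \<ge> 0"
  shows "((\<lambda>p. real (fst p) * c p) has_sum \<rho>) Omega"
    and "((\<lambda>p. real (snd p) * c p) has_sum \<sigma>) Omega"
proof -
  have nonneg: "0 \<le> c p" if "p \<in> Omega" for p
    using c that by (simp add: X_plus_mom_def X_plus_def)
  have r: "(\<Sum>\<^sub>\<infinity>p\<in>Omega. ennreal (real (fst p) * c p)) = ennreal \<rho>"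
    and s: "(\<Sum>\<^sub>\<infinity>p\<in>Omega. ennreal (real (snd p) * c p)) = ennreal \<sigma>"
    using c by (simp_all add: X_plus_mom_def rho_mom_def sigma_mom_def case_prod_unfold)
  have rs: "(\<lambda>p. real (fst p) * c p) summable_on Omega"
    by (rule summable_on_if_ennreal_infsum_finite) (auto simp: r nonneg)
  have ss: "(\<lambda>p. real (snd p) * c p) summable_on Omega"
    by (rule summable_on_if_ennreal_infsum_finite) (auto simp: s nonneg)
  have "ennreal (\<Sum>\<^sub>\<infinity>p\<in>Omega. real (fst p) * c p) = ennreal \<rho>"
    using ennreal_infsum[OF rs] r nonneg by simp
  then have "(\<Sum>\<^sub>\<infinity>p\<in>Omega. real (fst p) * c p) = \<rho>"
    using assms(2) nonneg by (subst (asm) ennreal_inj) (auto intro: infsum_nonneg)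
  with rs show "((\<lambda>p. real (fst p) * c p) has_sum \<rho>) Omega"
    by (metis has_sum_infsum)
  have "ennreal (\<Sum>\<^sub>\<infinity>p\<in>Omega. real (snd p) * c p) = ennreal \<sigma>"
    using ennreal_infsum[OF ss] s nonneg by simp
  then have "(\<Sum>\<^sub>\<infinity>p\<in>Omega. real (snd p) * c p) = \<sigma>"
    using assms(3) nonneg by (subst (asm) ennreal_inj) (auto intro: infsum_nonneg)
  with ss show "((\<lambda>p. real (snd p) * c p) has_sum \<sigma>) Omega"
    by (metis has_sum_infsum)
qed

lemma cbar_apply: "cbar Q z w p = z ^ fst p * w ^ snd p * Q p"
  by (simp add: cbar_def case_prod_unfold)

lemma existence_region_iff:
  assumes Q: "\<And>p. p \<in> Omega \<Longrightarrow> Q p > 0" and zw: "z \<ge> 0" "w \<ge> 0"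
  shows "(z, w) \<in> existence_region Q \<longleftrightarrow> (\<lambda>p. cluster_size p * cbar Q z w p) summable_on Omega"
proof -
  let ?C = "cbar Q z w"
  have nonneg: "0 \<le> ?C p" if "p \<in> Omega" for p
    using Q[OF that] zw by (simp add: cbar_apply)
  have "(z, w) \<in> existence_region Q \<longleftrightarrow> rho_mom ?C + sigma_mom ?C < \<infinity>"
    using zw by (simp add: existence_region_def)
  also have "rho_mom ?C + sigma_mom ?C = (\<Sum>\<^sub>\<infinity>p\<in>Omega. ennreal (cluster_size p * ?C p))"
    unfolding rho_mom_def sigma_mom_def case_prod_unfold prod.collapse
    by (subst infsum_add[symmetric])
      (auto intro!: infsum_cong nonneg_summable_on_complete
        simp: nonneg cluster_size_def distrib_right simp flip: ennreal_plus)
  finally have iff: "(z, w) \<in> existence_region Q \<longleftrightarrow>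
      (\<Sum>\<^sub>\<infinity>p\<in>Omega. ennreal (cluster_size p * ?C p)) < \<infinity>" .
  have n: "0 \<le> cluster_size p * ?C p" if "p \<in> Omega" for p
    using nonneg[OF that] by (simp add: cluster_size_def)
  show ?thesis
    unfolding iff using summable_on_if_ennreal_infsum_finite[OF _ n] ennreal_infsum[OF _ n]
    by fastforce
qed

lemma weighted_moment:
  assumes c: "c \<in> X_plus_mom \<rho> \<sigma>" and "\<rho> \<ge> 0" "\<sigma> \<ge> 0" "a \<ge> 0" "b \<ge> 0"
  shows "(\<Sum>\<^sub>\<infinity>p\<in>Omega. ennreal ((a * real (fst p) + b * real (snd p)) * c p)) = ennreal (a * \<rho> + b * \<sigma>)"
proof -
  have "((\<lambda>p. a * (real (fst p) * c p) + b * (real (snd p) * c p)) has_sum (a * \<rho> + b * \<sigma>)) Omega"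
    using X_plus_momD[OF assms(1-3)] by (intro has_sum_add has_sum_cmult_right)
  then have *: "((\<lambda>p. (a * real (fst p) + b * real (snd p)) * c p) has_sum (a * \<rho> + b * \<sigma>)) Omega"
    by (simp add: algebra_simps)
  show ?thesis
    using ennreal_infsum[OF has_sum_imp_summable[OF *]] assms infsumI[OF *]
    by (simp add: X_plus_mom_def X_plus_def)
qed

text \<open>
  The two sides are arranged so that all summands are nonnegative: the logarithms are split
  into positive and negative parts, and no subtraction in \<open>[0, \<infinity>]\<close> is needed.
\<close>

lemma rel_entropy_change_reference:
  assumes Q: "\<And>p. p \<in> Omega \<Longrightarrow> Q p > 0"
    and pos: "z > 0" "w > 0" "u > 0" "v > 0"
    and c: "c \<in> X_plus_mom \<rho> \<sigma>" and \<rho>\<sigma>: "\<rho> \<ge> 0" "\<sigma> \<ge> 0"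
  shows "rel_entropy c (cbar Q u v) + ((\<Sum>\<^sub>\<infinity>p\<in>Omega. ennreal (cbar Q z w p))
        + ennreal (max 0 (- ln (z / u)) * \<rho> + max 0 (- ln (w / v)) * \<sigma>))
    = rel_entropy c (cbar Q z w) + ((\<Sum>\<^sub>\<infinity>p\<in>Omega. ennreal (cbar Q u v p))
        + ennreal (max 0 (ln (z / u)) * \<rho> + max 0 (ln (w / v)) * \<sigma>))"
proof -
  let ?A = "ln (z / u)" and ?B = "ln (w / v)"
  let ?C = "cbar Q z w" and ?D = "cbar Q u v"
  let ?m = "\<lambda>p. (max 0 (- ?A) * real (fst p) + max 0 (- ?B) * real (snd p)) * c p"
  let ?n = "\<lambda>p. (max 0 ?A * real (fst p) + max 0 ?B * real (snd p)) * c p"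
  have terms: "ennreal (?D p * Psi (c p / ?D p)) + (ennreal (?C p) + ennreal (?m p))
      = ennreal (?C p * Psi (c p / ?C p)) + (ennreal (?D p) + ennreal (?n p))"
    if p: "p \<in> Omega" for p
  proof -
    have CD: "?C p > 0" "?D p > 0" using Q[OF p] pos by (auto simp: cbar_apply)
    have c0: "c p \<ge> 0" using c p by (simp add: X_plus_mom_def X_plus_def)
    have lnC: "ln (?C p) = real (fst p) * ln z + real (snd p) * ln w + ln (Q p)"
      and lnD: "ln (?D p) = real (fst p) * ln u + real (snd p) * ln v + ln (Q p)"
      using Q[OF p] pos by (simp_all add: cbar_apply ln_mult ln_realpow)
    \<comment> \<open>The factor \<open>Q p\<close> drops out of
      \<open>ln (?C p) - ln (?D p)\<close>, leaving an expression linear in the two indices. Hence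
      changing the reference costs only a combination of the prescribed moments.\<close>
    have "?n p - ?m p = (?A * real (fst p) + ?B * real (snd p)) * c p"
      by (simp add: max_def algebra_simps)
    also have "\<dots> = c p * (ln (?C p) - ln (?D p))"
      using pos by (simp add: lnC lnD ln_div algebra_simps)
    finally have nm: "?n p = ?m p + c p * (ln (?C p) - ln (?D p))" by simp
    have "?D p * Psi (c p / ?D p) + (?C p + ?m p) = ?C p * Psi (c p / ?C p) + (?D p + ?n p)"
    proof (cases "c p = 0")
      case True
      then show ?thesis by (simp add: Psi_def)
    next
      case False
      then have "c p > 0" using c0 by simp
      then show ?thesis
        unfolding nm using CD by (simp add: Psi_def ln_div algebra_simps)
    qed
    moreover have "0 \<le> ?m p" "0 \<le> ?n p" "0 \<le> Psi (c p / ?D p)" "0 \<le> Psi (c p / ?C p)"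
      using c0 CD by (auto intro!: Psi_nonneg mult_nonneg_nonneg add_nonneg_nonneg)
    ultimately show ?thesis
      using CD by (simp flip: ennreal_plus)
  qed
  have "(\<Sum>\<^sub>\<infinity>p\<in>Omega. ennreal (?D p * Psi (c p / ?D p)) + (ennreal (?C p) + ennreal (?m p)))
      = (\<Sum>\<^sub>\<infinity>p\<in>Omega. ennreal (?C p * Psi (c p / ?C p)) + (ennreal (?D p) + ennreal (?n p)))"
    by (rule infsum_cong) (rule terms)
  moreover have "(\<Sum>\<^sub>\<infinity>p\<in>Omega. f p + (g p + h p)) = infsum f Omega + (infsum g Omega + infsum h Omega)"
    for f g h :: "nat \<times> nat \<Rightarrow> ennreal"
    by (simp add: infsum_add nonneg_summable_on_complete)
  ultimately show ?thesis
    using weighted_moment[OF c \<rho>\<sigma>, of "max 0 (- ?A)" "max 0 (- ?B)"]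
      weighted_moment[OF c \<rho>\<sigma>, of "max 0 ?A" "max 0 ?B"]
    by (simp add: rel_entropy_def)
qed

section \<open>Competitors from perturbations, and pointwise convergence from entropy\<close>

lemma rel_entropy_finite_perturbation:
  assumes C: "\<And>p. p \<in> Omega \<Longrightarrow> C p > 0"
    and d: "finite_perturbation C F d" "perturbation_data C F d = (a, b, h)"
    and \<rho>: "((\<lambda>p. real (fst p) * C p) has_sum \<rho>) Omega"
    and \<sigma>: "((\<lambda>p. real (snd p) * C p) has_sum \<sigma>) Omega"
  shows "(\<lambda>p. C p + d p) \<in> X_plus_mom (\<rho> + a) (\<sigma> + b)"
    and "rel_entropy (\<lambda>p. C p + d p) C = ennreal h"
proof -
  have F: "finite F" "F \<subseteq> Omega" and d0: "\<And>x. x \<notin> F \<Longrightarrow> d x = 0"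
    and nonneg: "\<And>p. p \<in> F \<Longrightarrow> 0 \<le> C p + d p"
    using d(1) unfolding finite_perturbation_def by blast+
  have fin: "((\<lambda>p. g p * d p) has_sum (\<Sum>p\<in>F. g p * d p)) Omega" for g :: "nat \<times> nat \<Rightarrow> real"
    by (rule has_sum_cong_neutral[THEN iffD1, OF _ _ _ has_sum_finite[OF F(1)]]) (use F d0 in auto)
  have C0: "0 \<le> C p + d p" if "p \<in> Omega" for p
    using nonneg C[OF that] d0[of p] by (cases "p \<in> F") auto
  show "(\<lambda>p. C p + d p) \<in> X_plus_mom (\<rho> + a) (\<sigma> + b)"
    using has_sum_add[OF \<rho> fin[of "\<lambda>p. real (fst p)"]] has_sum_add[OF \<sigma> fin[of "\<lambda>p. real (snd p)"]] d(2)
    by (intro X_plus_momI) (auto simp: C0 distrib_left perturbation_data_def)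
  have off: "Psi ((C p + d p) / C p) = 0" if "p \<in> Omega - F" for p
    using that C[of p] d0[of p] by fastforce
  have "rel_entropy (\<lambda>p. C p + d p) C = (\<Sum>\<^sub>\<infinity>p\<in>F. ennreal (C p * Psi ((C p + d p) / C p)))"
    unfolding rel_entropy_def using F off by (intro infsum_cong_neutral) auto
  also have "\<dots> = (\<Sum>p\<in>F. ennreal (C p * Psi ((C p + d p) / C p)))"
    using F by simp
  also have "\<dots> = ennreal (\<Sum>p\<in>F. C p * Psi ((C p + d p) / C p))"
    using F C nonneg by (intro sum_ennreal mult_nonneg_nonneg Psi_nonneg divide_nonneg_pos) (auto simp: less_imp_le)
  finally show "rel_entropy (\<lambda>p. C p + d p) C = ennreal h"
    using d(2) by (simp add: perturbation_data_def)
qed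

text \<open>All entropy terms are nonnegative, so each single term is dominated by the whole sum and
  tends to 0; then \<open>Psi\<close> of the ratio tends to 0 and the ratio to 1.\<close>

lemma pointwise_limit_if_rel_entropy_tendsto_0:
  assumes C: "\<And>p. p \<in> Omega \<Longrightarrow> C p > 0" and c: "\<And>n p. p \<in> Omega \<Longrightarrow> 0 \<le> c n p"
    and lim: "(\<lambda>n. rel_entropy (c n) C) \<longlonglongrightarrow> 0" and p: "p \<in> Omega"
  shows "(\<lambda>n. c n p) \<longlonglongrightarrow> C p"
proof -
  have Cp: "C p > 0" by (rule C[OF p])
  have Psi0: "0 \<le> Psi (c n p / C p)" for n
    using c[OF p, of n] Cp by (intro Psi_nonneg) auto
  have "ennreal (C p * Psi (c n p / C p)) \<le> rel_entropy (c n) C" for n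
  proof -
    have "(\<Sum>\<^sub>\<infinity>q\<in>{p}. ennreal (C q * Psi (c n q / C q))) \<le> rel_entropy (c n) C"
      unfolding rel_entropy_def using p
      by (intro infsum_mono_neutral nonneg_summable_on_complete) auto
    then show ?thesis by simp
  qed
  then have "(\<lambda>n. ennreal (C p * Psi (c n p / C p))) \<longlonglongrightarrow> ennreal 0"
    using tendsto_sandwich[OF _ _ tendsto_const lim] by simp
  then have "(\<lambda>n. C p * Psi (c n p / C p)) \<longlonglongrightarrow> 0"
    by (subst (asm) tendsto_ennreal_iff) (use Psi0 Cp in auto)
  from tendsto_mult_left[OF this, of "1 / C p"]
  have "(\<lambda>n. Psi (c n p / C p)) \<longlonglongrightarrow> 0" using Cp by simp
  then have "(\<lambda>n. c n p / C p) \<longlonglongrightarrow> 1"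
    by (intro tendsto_1_if_Psi_tendsto_0) (use c[OF p] Cp in auto)
  from tendsto_mult_left[OF this, of "C p"] show ?thesis
    using Cp by simp
qed

section \<open>From the variational inequality to the normal cone condition\<close>

text \<open>Lowering both exponents by \<open>\<epsilon>\<close> multiplies the term of size
  \<open>t\<close> by \<open>exp (- \<epsilon> * t)\<close>. As
  \<open>t * exp (- \<epsilon> * t) \<le> 1 / \<epsilon>\<close>, this absorbs the weight by which
  membership in the region exceeds plain summability.\<close>

lemma tilted_existence_region:
  assumes Q: "\<And>p. p \<in> Omega \<Longrightarrow> Q p > 0" and zw: "z > 0" "w > 0" and \<epsilon>: "\<epsilon> > 0"
    and sum: "(\<lambda>x. cbar Q z w x * exp (p * real (fst x) + q * real (snd x))) summable_on Omega"
  shows "(z * exp (p - \<epsilon>), w * exp (q - \<epsilon>)) \<in> existence_region Q"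
proof -
  let ?T = "\<lambda>x. cbar Q z w x * exp (p * real (fst x) + q * real (snd x))"
  have T0: "0 \<le> ?T x" if "x \<in> Omega" for x
    using Q[OF that] zw by (simp add: cbar_apply)
  have eq: "cbar Q (z * exp (p - \<epsilon>)) (w * exp (q - \<epsilon>)) x = ?T x * exp (- \<epsilon> * cluster_size x)" for x
  proof -
    have "exp (p - \<epsilon>) ^ fst x * exp (q - \<epsilon>) ^ snd x
        = exp (p * real (fst x) + q * real (snd x)) * exp (- \<epsilon> * cluster_size x)"
      by (simp add: cluster_size_def algebra_simps flip: exp_of_nat_mult exp_add)
    then show ?thesis
      by (simp add: cbar_apply power_mult_distrib mult_ac)
  qed
  have le: "cluster_size x * (?T x * exp (- \<epsilon> * cluster_size x)) \<le> 1 / \<epsilon> * ?T x" if "x \<in> Omega" for x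
  proof -
    have "\<epsilon> * cluster_size x \<le> exp (\<epsilon> * cluster_size x)"
      using exp_ge_add_one_self[of "\<epsilon> * cluster_size x"] by linarith
    then have "cluster_size x * exp (- \<epsilon> * cluster_size x) \<le> 1 / \<epsilon>"
      using \<epsilon> by (simp add: exp_minus field_simps)
    from mult_right_mono[OF this T0[OF that]] show ?thesis by (simp only: mult_ac)
  qed
  have "(\<lambda>x. cluster_size x * (?T x * exp (- \<epsilon> * cluster_size x))) summable_on Omega"
    by (rule summable_on_comparison_test[OF summable_on_cmult_right[OF sum] le])
      (use T0 in \<open>auto simp: cluster_size_def\<close>)
  then show ?thesis
    using zw by (simp add: existence_region_iff[OF Q] eq)
qed

text \<open>The inequality is tested at the tilted pair, where the logarithms become
  \<open>\<epsilon> - p\<close> and \<open>\<epsilon> - q\<close>; then \<open>\<epsilon>\<close>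
  tends to 0.\<close>

lemma variational_imp_normal_cone:
  assumes Q: "\<And>p. p \<in> Omega \<Longrightarrow> Q p > 0" and zw: "z > 0" "w > 0"
    and variational: "\<And>x y. x > 0 \<Longrightarrow> y > 0 \<Longrightarrow> (x, y) \<in> existence_region Q \<Longrightarrow>
      ln (z / x) * a + ln (w / y) * b \<ge> 0"
    and sum: "(\<lambda>x. cbar Q z w x * exp (p * real (fst x) + q * real (snd x))) summable_on Omega"
  shows "p * a + q * b \<le> 0"
proof -
  have "p * a + q * b \<le> \<epsilon> * (a + b)" if "\<epsilon> > 0" for \<epsilon>
  proof -
    have ln: "ln (z / (z * exp (p - \<epsilon>))) = \<epsilon> - p" "ln (w / (w * exp (q - \<epsilon>))) = \<epsilon> - q"
      using zw by (simp_all add: ln_div ln_mult)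
    have "0 \<le> (\<epsilon> - p) * a + (\<epsilon> - q) * b"
      using variational[OF _ _ tilted_existence_region[OF Q zw that sum]] zw unfolding ln by simp
    then show ?thesis
      by (simp add: algebra_simps)
  qed
  then have "\<forall>\<^sub>F \<epsilon> in at_right 0. p * a + q * b \<le> \<epsilon> * (a + b)"
    by (intro eventually_at_right_less[THEN eventually_mono])
  moreover have "((\<lambda>\<epsilon>. \<epsilon> * (a + b)) \<longlongrightarrow> 0) (at_right 0)"
    by (intro tendsto_eq_intros | simp)+
  ultimately show ?thesis
    by (intro tendsto_lowerbound) auto
qed

section \<open>Weak* convergence of minimising sequences\<close>

theorem corollary4p4:
  fixes Q :: "nat \<times> nat \<Rightarrow> real" and \<rho> \<sigma> z w u v :: real
    and c :: "nat \<Rightarrow> nat \<times> nat \<Rightarrow> real"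
  assumes Q_pos: "\<And>p. p \<in> Omega \<Longrightarrow> Q p > 0"
    and Q_one: "Q (1, 0) = 1" "Q (0, 1) = 1"
    and region: "\<exists>a b. a > 0 \<and> b > 0 \<and> (a, b) \<in> existence_region Q"
    and moments_pos: "\<rho> > 0" "\<sigma> > 0"
    and zw: "z > 0" "w > 0" "(z, w) \<in> existence_region Q"
    and variational: "\<And>a b. a > 0 \<Longrightarrow> b > 0 \<Longrightarrow> (a, b) \<in> existence_region Q \<Longrightarrow>
      ln (z / a) * (\<rho> - enn2real (rho_mom (cbar Q z w)))
        + ln (w / b) * (\<sigma> - enn2real (sigma_mom (cbar Q z w))) \<ge> 0"
    and uv: "u > 0" "v > 0" "(u, v) \<in> existence_region Q"
    and c_mem: "\<And>n. c n \<in> X_plus_mom \<rho> \<sigma>"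
    and c_min: "(\<lambda>n. rel_entropy (c n) (cbar Q u v))
      \<longlonglongrightarrow> (INF d\<in>X_plus_mom \<rho> \<sigma>. rel_entropy d (cbar Q u v))"
  shows "limitin weak_star_topology c (cbar Q z w) sequentially"
proof -
  define C where "C = cbar Q z w"
  define \<rho>' where "\<rho>' = enn2real (rho_mom C)"
  define \<sigma>' where "\<sigma>' = enn2real (sigma_mom C)"
  define a where "a = \<rho> - \<rho>'"
  define b where "b = \<sigma> - \<sigma>'"
  have C: "C p > 0" if "p \<in> Omega" for p
    using Q_pos[OF that] zw by (simp add: C_def cbar_apply)
  have Csum: "(\<lambda>p. cluster_size p * C p) summable_on Omega"
    using zw existence_region_iff[OF Q_pos, where z = z and w = w] by (simp add: C_def)
  then have CX: "C \<in> X_space"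
    unfolding X_space_iff by (rule summable_on_cong[THEN iffD1, rotated]) (use C in \<open>simp add: less_imp_le\<close>)
  have "rho_mom C < \<infinity>" "sigma_mom C < \<infinity>"
    using zw(3) by (auto simp: existence_region_def C_def)
  then have Cmem: "C \<in> X_plus_mom \<rho>' \<sigma>'"
    using CX C by (simp add: X_plus_mom_def X_plus_def \<rho>'_def \<sigma>'_def less_imp_le)
  have C\<rho>: "((\<lambda>p. real (fst p) * C p) has_sum \<rho>') Omega"
    and C\<sigma>: "((\<lambda>p. real (snd p) * C p) has_sum \<sigma>') Omega"
    using X_plus_momD[OF Cmem] by (simp_all add: \<rho>'_def \<sigma>'_def)
  have normal_cone: "p * a + q * b \<le> 0"
    if "(\<lambda>x. C x * exp (p * real (fst x) + q * real (snd x))) summable_on Omega" for p q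
    using variational_imp_normal_cone[OF Q_pos zw(1,2) variational that[unfolded C_def]]
    by (simp add: a_def b_def \<rho>'_def \<sigma>'_def C_def)
  have Cdecr: "(\<lambda>x. C x * exp (p * real (fst x) + q * real (snd x))) summable_on Omega"
    if "p \<le> 0" "q \<le> 0" for p q
  proof (rule summable_on_comparison_test[OF Csum])
    fix x assume x: "x \<in> Omega"
    have "p * real (fst x) + q * real (snd x) \<le> 0"
      using that by (intro add_nonpos_nonpos mult_nonpos_nonneg) auto
    then have "exp (p * real (fst x) + q * real (snd x)) \<le> cluster_size x"
      using cluster_size_ge_1[OF x] by (meson exp_le_one_iff order_trans)
    from mult_right_mono[OF this, of "C x"] C[OF x]
    show "C x * exp (p * real (fst x) + q * real (snd x)) \<le> cluster_size x * C x"
      by (simp add: mult_ac)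
  qed (use C in \<open>auto simp: less_imp_le\<close>)
  \<comment> \<open>Tilts with nonpositive exponents keep \<open>C\<close> summable. The directions
    \<open>(-1, 0)\<close> and \<open>(0, -1)\<close> therefore show that the moments of
    \<open>C\<close> do not exceed the prescribed ones.\<close>
  have ab: "a \<ge> 0" "b \<ge> 0"
    using normal_cone[OF Cdecr, of "-1" 0] normal_cone[OF Cdecr, of 0 "-1"] by auto
  have recovery: "\<exists>d\<in>X_plus_mom \<rho> \<sigma>. rel_entropy d C \<le> ennreal \<delta>" if \<delta>: "\<delta> > 0" for \<delta>
  proof -
    obtain F d h where d: "finite_perturbation C F d" "perturbation_data C F d = (a, b, h)" and "h < \<delta>"
      using small_entropy_perturbation[OF C Csum ab \<delta> normal_cone] by blast
    from rel_entropy_finite_perturbation[OF C d C\<rho> C\<sigma>] \<open>h < \<delta>\<close> show ?thesis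
      by (intro bexI[of _ "\<lambda>p. C p + d p"]) (auto simp: a_def b_def intro: ennreal_leI)
  qed
  define K where "K = (\<Sum>\<^sub>\<infinity>p\<in>Omega. ennreal (cbar Q z w p))
    + ennreal (max 0 (- ln (z / u)) * \<rho> + max 0 (- ln (w / v)) * \<sigma>)"
  define L where "L = (\<Sum>\<^sub>\<infinity>p\<in>Omega. ennreal (cbar Q u v p))
    + ennreal (max 0 (ln (z / u)) * \<rho> + max 0 (ln (w / v)) * \<sigma>)"
  have change: "rel_entropy d (cbar Q u v) + K = rel_entropy d C + L" if "d \<in> X_plus_mom \<rho> \<sigma>" for d
    unfolding K_def L_def C_def
    using rel_entropy_change_reference[OF Q_pos zw(1,2) uv(1,2) that] moments_pos by simp
  have D0: "0 \<le> cbar Q u v p" if "p \<in> Omega" for p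
    using Q_pos[OF that] uv by (simp add: cbar_apply)
  \<comment> \<open>This makes \<open>L\<close> finite, so that \<open>L\<close> can later be
    cancelled in \<open>ennreal\<close>. Summability follows from membership in the region because
    the weight there is at least 1.\<close>
  have Dsum: "cbar Q u v summable_on Omega"
  proof (rule summable_on_comparison_test)
    show "(\<lambda>p. cluster_size p * cbar Q u v p) summable_on Omega"
      using uv existence_region_iff[OF Q_pos, where z = u and w = v] by simp
    show "cbar Q u v p \<le> cluster_size p * cbar Q u v p" if "p \<in> Omega" for p
      using mult_right_mono[OF cluster_size_ge_1[OF that] D0[OF that]] by simp
  qed (rule D0)
  have "(\<Sum>\<^sub>\<infinity>p\<in>Omega. ennreal (cbar Q u v p)) = ennreal (infsum (cbar Q u v) Omega)"
    by (rule ennreal_infsum[OF Dsum D0])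
  then have Lfin: "L < \<infinity>"
    by (simp add: L_def)
  define I where "I = (INF d\<in>X_plus_mom \<rho> \<sigma>. rel_entropy d (cbar Q u v))"
  \<comment> \<open>The subtraction-free form of the statement that the infimum of the entropy
    relative to \<open>C\<close> is 0, obtained by inserting the competitors from
    \<open>recovery\<close>.\<close>
  have IK: "I + K \<le> L"
  proof (rule ennreal_le_epsilon)
    fix \<delta> :: real assume "\<delta> > 0"
    then obtain d where d: "d \<in> X_plus_mom \<rho> \<sigma>" "rel_entropy d C \<le> ennreal \<delta>"
      using recovery by blast
    have "I + K \<le> rel_entropy d (cbar Q u v) + K"
      unfolding I_def using d(1) by (intro add_right_mono INF_lower)
    also have "\<dots> \<le> L + ennreal \<delta>"
      unfolding change[OF d(1)] add.commute[of _ L] using d(2) by (intro add_left_mono)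
    finally show "I + K \<le> L + ennreal \<delta>" .
  qed
  have "(\<lambda>n. rel_entropy (c n) (cbar Q u v) + K) \<longlonglongrightarrow> I + K"
    unfolding I_def by (intro tendsto_add c_min tendsto_const)
  then have lim: "(\<lambda>n. rel_entropy (c n) C + L) \<longlonglongrightarrow> I + K"
    by (simp add: change c_mem)
  have "(\<lambda>n. rel_entropy (c n) C) \<longlonglongrightarrow> 0"
  proof (rule order_tendstoI)
    fix e :: ennreal assume "0 < e"
    \<comment> \<open>Finiteness of \<open>L\<close> makes \<open>L < L + e\<close> strict. The
      entropies plus \<open>L\<close> converge to \<open>I + K\<close>, hence eventually stay below
      \<open>L + e\<close>, and \<open>L\<close> cancels.\<close>
    then have "I + K < L + e"
      using IK Lfin by (metis add.commute add_0 ennreal_add_left_cancel_less infinity_ennreal_def less_top order_le_less_trans)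
    from order_tendstoD(2)[OF lim this]
    show "\<forall>\<^sub>F n in sequentially. rel_entropy (c n) C < e"
      by (rule eventually_mono) (metis add.commute ennreal_add_left_cancel_less)
  qed simp
  then have pointwise: "(\<lambda>n. c n p) \<longlonglongrightarrow> C p" if "p \<in> Omega" for p
    using c_mem C that
    by (intro pointwise_limit_if_rel_entropy_tendsto_0) (auto simp: X_plus_mom_def X_plus_def)
  show ?thesis
    unfolding C_def[symmetric]
  proof (rule weak_star_limit_if_bounded_pointwise[OF _ CX _ pointwise])
    show "c n \<in> X_space" for n
      using c_mem[of n] by (simp add: X_plus_mom_def X_plus_def)
    \<comment> \<open>On nonnegative sequences the norm is the sum of the two moments, so every
      \<open>c n\<close> has norm exactly \<open>\<rho> + \<sigma>\<close>.\<close>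
    show "(\<Sum>\<^sub>\<infinity>p\<in>Omega. cluster_size p * \<bar>c n p\<bar>) \<le> \<rho> + \<sigma>" for n
    proof -
      have "(\<Sum>\<^sub>\<infinity>p\<in>Omega. cluster_size p * \<bar>c n p\<bar>)
          = (\<Sum>\<^sub>\<infinity>p\<in>Omega. real (fst p) * c n p + real (snd p) * c n p)"
        using c_mem[of n]
        by (intro infsum_cong) (simp add: X_plus_mom_def X_plus_def cluster_size_def distrib_right)
      also have "\<dots> = \<rho> + \<sigma>"
        using X_plus_momD[OF c_mem[of n]] moments_pos by (intro infsumI has_sum_add) auto
      finally show ?thesis by simp
    qed
  qed
qed

end
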